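(* For every $\lambda,k,n\geq 1$, there exists an $n$-vertex directed graph $G$ with a designated source vertex $s$ such that every $(\lambda,k)$-FT-BFP of $G$ (in particular an optimal one) contains $\Omega(\min\{2^k\lambda n,n^2\})$ edges.
   Context: All edges have unit capacity; $\textsc{max-flow}(s,t,G)$ denotes the maximum number of pairwise edge-disjoint $s$-to-$t$ paths in $G$. For $F\subseteq E$, $G\setminus F$ is $G$ with the edges of $F$ deleted. Given a directed graph $G=(V,E)$ with designated source $s$, a $(\lambda,k)$-FT-BFP of $G$ is a subgraph $H=(V,E_H)$ with $E_H\subseteq E$ such that for every $F\subseteq E$ with $|F|\leq k$ and every $t\in V$: if $\textsc{max-flow}(s,t,G\setminus F)\leq\lambda$ then $\textsc{max-flow}(s,t,H\setminus F)=\textsc{max-flow}(s,t,G\setminus F)$, and otherwise $\textsc{max-flow}(s,t,H\setminus F)\geq\lambda$.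
   Formalization: The edge bound, with one absolute constant for all λ, k, n, is claimed only for n ≥ 2: for n = 1 the edgeless one-vertex graph is itself a (λ,k)-FT-BFP with 0 edges, while min{2^k λ n, n²} = 1. *)

theory Defs
  imports Complex_Main "Graph_Theory.Graph_Theory"
begin

definition del_arcs :: "('a, 'b) pre_digraph \<Rightarrow> 'b set \<Rightarrow> ('a, 'b) pre_digraph" where
  "del_arcs G F = \<lparr> verts = verts G, arcs = arcs G - F, tail = tail G, head = head G \<rparr>"

text \<open>
  Only meaningful for finite digraphs, where the set under \<^const>\<open>Max\<close> is finite and
  nonempty. For \<open>s = t\<close> the empty path is the only one, so the value is 1 in every graph
  containing \<open>s\<close>, and the target \<open>s\<close> imposes no condition on a preserver.
\<close>
definition max_flow :: "'a \<Rightarrow> 'a \<Rightarrow> ('a, 'b) pre_digraph \<Rightarrow> nat" where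
  "max_flow s t G =
     Max {card P | P. P \<subseteq> {p. pre_digraph.apath G s p t} \<and>
                      pairwise (\<lambda>p q. set p \<inter> set q = {}) P}"

definition ft_bfp ::
    "nat \<Rightarrow> nat \<Rightarrow> ('a, 'b) pre_digraph \<Rightarrow> 'a \<Rightarrow> ('a, 'b) pre_digraph \<Rightarrow> bool" where
  "ft_bfp l k G s H \<longleftrightarrow>
     spanning H G \<and>
     (\<forall>F t. F \<subseteq> arcs G \<and> finite F \<and> card F \<le> k \<and> t \<in> verts G \<longrightarrow>
        (if max_flow s t (del_arcs G F) \<le> l
         then max_flow s t (del_arcs H F) = max_flow s t (del_arcs G F)
         else max_flow s t (del_arcs H F) \<ge> l))"

end

theory Submission
  imports Defs "HOL-Library.Disjoint_Sets"
begin

text \<open>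
  If the maximum flow after deleting at most \<open>k\<close> arcs equals the capacity of some cut and is at most
  \<open>l\<close>, then a preserver contains every arc of that cut. Take \<open>a \<le> l\<close> disjoint binary trees of depth
  at most \<open>k\<close>, attach each root to the source by one arc, and join every leaf to every vertex of a
  set of sinks. Fix a leaf \<open>j\<close> and a sink \<open>x\<close>, and delete the at most \<open>k\<close> arcs that branch off the
  path from the root above \<open>j\<close> down to \<open>j\<close>. Each tree still carries one path to \<open>x\<close>, and the arc
  \<open>(j, x)\<close> together with the arcs from the source to the other \<open>a - 1\<close> roots is a cut of capacity
  \<open>a\<close>. Hence all arcs between leaves and sinks are needed, and linearly many sinks below
  \<open>min (2 ^ k * l) (n div 3)\<close> leaves give the bound.
\<close>

section \<open>Flows, cuts and preservers\<close>

definition cut_arcs :: "('a, 'b) pre_digraph \<Rightarrow> 'a set \<Rightarrow> 'b set" where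
  "cut_arcs G S = {e \<in> arcs G. tail G e \<in> S \<and> head G e \<notin> S}"

lemma del_arcs_simps [simp]:
  "verts (del_arcs G F) = verts G"
  "arcs (del_arcs G F) = arcs G - F"
  "tail (del_arcs G F) = tail G"
  "head (del_arcs G F) = head G"
  by (simp_all add: del_arcs_def)

lemma del_arcs_empty [simp]: "del_arcs G {} = G"
  by (simp add: del_arcs_def)

lemma (in fin_digraph) fin_digraph_del_arcs: "fin_digraph (del_arcs G F)"
  by unfold_locales auto

lemma (in fin_digraph) max_flow_le_iff:
  "max_flow s t G \<le> c \<longleftrightarrow>
     (\<forall>P. P \<subseteq> {p. apath s p t} \<and> pairwise (\<lambda>p q. set p \<inter> set q = {}) P \<longrightarrow> card P \<le> c)"
proof -
  let ?sizes = "{card P | P. P \<subseteq> {p. apath s p t} \<and> pairwise (\<lambda>p q. set p \<inter> set q = {}) P}"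
  have "?sizes \<subseteq> card ` Pow {p. apath s p t}"
    by auto
  then have "finite ?sizes"
    by (rule finite_subset) (simp add: apaths_finite)
  moreover have "?sizes \<noteq> {}"
    by (auto intro: exI[of _ "{}"])
  ultimately show ?thesis
    unfolding max_flow_def by (subst Max_le_iff) auto
qed

lemma (in fin_digraph) card_le_max_flow:
  assumes "s \<noteq> t" and walk: "\<And>i. i \<in> I \<Longrightarrow> awalk s (p i) t"
    and disj: "disjoint_family_on (\<lambda>i. set (p i)) I"
  shows "card I \<le> max_flow s t G"
proof -
  define q where "q i = awalk_to_apath (p i)" for i
  have shortened: "apath s (q i) t" "set (q i) \<subseteq> set (p i)" if "i \<in> I" for i
    using apath_awalk_to_apath awalk_to_apath_subset walk[OF that] by (simp_all add: q_def)
  have shortened_disj: "set (q i) \<inter> set (q j) = {}" if "i \<in> I" "j \<in> I" "i \<noteq> j" for i j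
    using shortened(2)[OF that(1)] shortened(2)[OF that(2)] disjoint_family_onD[OF disj that] by blast
  have "set (q i) \<noteq> {}" if "i \<in> I" for i
    using shortened(1)[OF that] \<open>s \<noteq> t\<close> by (auto simp: apath_Nil_iff)
  then have "inj_on q I"
    using shortened_disj by (intro inj_onI) (metis Int_absorb)
  then have "card I = card (q ` I)"
    by (simp add: card_image)
  also have "\<dots> \<le> max_flow s t G"
  proof (rule max_flow_le_iff[THEN iffD1, rule_format, OF order_refl], rule conjI)
    show "q ` I \<subseteq> {p. apath s p t}"
      using shortened(1) by blast
    show "pairwise (\<lambda>p q. set p \<inter> set q = {}) (q ` I)"
      using shortened_disj by (auto simp: pairwise_def)
  qed
  finally show ?thesis .
qed

lemma (in wf_digraph) awalk_meets_cut_arcs: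
  assumes "awalk s p t" "s \<in> S" "t \<notin> S"
  shows "set p \<inter> cut_arcs G S \<noteq> {}"
  using assms
proof (induction p arbitrary: s)
  case Nil
  then show ?case by (simp add: awalk_Nil_iff)
next
  case (Cons e p)
  then show ?case by (cases "head G e \<in> S") (auto simp: awalk_Cons_iff cut_arcs_def)
qed

lemma (in fin_digraph) max_flow_le_card_cut_arcs:
  assumes "s \<in> S" "t \<notin> S"
  shows "max_flow s t G \<le> card (cut_arcs G S)"
  unfolding max_flow_le_iff
proof (intro allI impI, elim conjE)
  fix P assume paths: "P \<subseteq> {p. apath s p t}" and disj: "pairwise (\<lambda>p q. set p \<inter> set q = {}) P"
  have "\<exists>e. e \<in> set p \<inter> cut_arcs G S" if "p \<in> P" for p
    using awalk_meets_cut_arcs[OF awalkI_apath assms] paths that by blast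
  then obtain f where cut_arc: "\<And>p. p \<in> P \<Longrightarrow> f p \<in> set p \<inter> cut_arcs G S"
    by metis
  have "inj_on f P"
    using cut_arc pairwiseD[OF disj] by (intro inj_onI) (metis IntE disjoint_iff)
  moreover have "finite (cut_arcs G S)"
    by (simp add: cut_arcs_def)
  ultimately show "card P \<le> card (cut_arcs G S)"
    using cut_arc by (intro card_inj_on_le[of f]) auto
qed

lemma (in fin_digraph) tight_cut_arcs_subset_ft_bfp:
  assumes preserver: "ft_bfp l k G s H" and deleted: "F \<subseteq> arcs G" "card F \<le> k"
    and separates: "s \<in> S" "t \<in> verts G - S"
    and tight: "card (cut_arcs (del_arcs G F) S) \<le> max_flow s t (del_arcs G F)"
    and small: "card (cut_arcs (del_arcs G F) S) \<le> l"
  shows "cut_arcs (del_arcs G F) S \<subseteq> arcs H"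
proof -
  let ?C = "cut_arcs (del_arcs G F) S"
  have sub: "subgraph H G"
    using preserver by (simp add: ft_bfp_def spanning_def)
  interpret GF: fin_digraph "del_arcs G F"
    by (rule fin_digraph_del_arcs)
  interpret HF: fin_digraph "del_arcs H F"
    by (rule fin_digraph.fin_digraph_del_arcs[OF fin_digraph_subgraph[OF sub]])
  have "max_flow s t (del_arcs G F) = card ?C"
    using GF.max_flow_le_card_cut_arcs separates tight by (intro antisym) auto
  moreover have "finite F"
    using deleted(1) by (rule finite_subset) simp
  ultimately have "card ?C = max_flow s t (del_arcs H F)"
    using preserver deleted separates(2) small by (simp add: ft_bfp_def)
  also have "\<dots> \<le> card (cut_arcs (del_arcs H F) S)"
    using HF.max_flow_le_card_cut_arcs separates by auto
  also have "cut_arcs (del_arcs H F) S = ?C \<inter> arcs H"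
    using sub by (auto simp: subgraph_def compatible_def cut_arcs_def)
  finally have "?C \<inter> arcs H = ?C"
    by (intro card_seteq) (auto simp: cut_arcs_def)
  then show ?thesis by blast
qed

lemma (in fin_digraph) finite_arcs_ft_bfp:
  assumes "ft_bfp l k G s H"
  shows "finite (arcs H)"
  using assms fin_digraph.finite_arcs[OF fin_digraph_subgraph]
  by (simp add: ft_bfp_def spanning_def)

section \<open>Star graphs\<close>

definition star_graph :: "nat \<Rightarrow> (nat, nat \<times> nat) pre_digraph" where
  "star_graph n = \<lparr> verts = {..<n}, arcs = {0} \<times> {1..<n}, tail = fst, head = snd \<rparr>"

lemma star_graph_simps [simp]:
  "verts (star_graph n) = {..<n}"
  "arcs (star_graph n) = {0} \<times> {1..<n}"
  "tail (star_graph n) = fst"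
  "head (star_graph n) = snd"
  by (simp_all add: star_graph_def)

lemma digraph_star_graph: "digraph (star_graph n)"
  by unfold_locales (auto simp: arc_to_ends_def)

lemma card_arcs_ft_bfp_star_graph:
  assumes "1 \<le> l" and preserver: "ft_bfp l k (star_graph n) 0 H"
  shows "n - 1 \<le> card (arcs H)"
proof -
  interpret digraph "star_graph n"
    by (rule digraph_star_graph)
  have "(0, i) \<in> arcs H" if leaf: "i \<in> {1..<n}" for i
  proof -
    have cut: "cut_arcs (star_graph n) (- {i}) = {(0, i)}"
      using leaf by (auto simp: cut_arcs_def)
    have "card {()} \<le> max_flow 0 i (star_graph n)"
      using leaf by (intro card_le_max_flow[where p = "\<lambda>_. [(0, i)]"])
        (auto simp: awalk_simps disjoint_family_on_def)
    then have "cut_arcs (star_graph n) (- {i}) \<subseteq> arcs H"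
      using tight_cut_arcs_subset_ft_bfp[OF preserver, of "{}" "- {i}" i] leaf \<open>1 \<le> l\<close>
      by (simp add: cut)
    then show ?thesis
      by (simp add: cut)
  qed
  then have "{0} \<times> {1..<n} \<subseteq> arcs H"
    by auto
  then have "card ({0 :: nat} \<times> {1..<n}) \<le> card (arcs H)"
    by (rule card_mono[OF finite_arcs_ft_bfp[OF preserver]])
  then show ?thesis by simp
qed

section \<open>Ancestors in heap numbering\<close>

text \<open>The children of \<open>v\<close> are \<open>2 * v\<close> and \<open>2 * v + 1\<close>.\<close>

definition ancestor :: "nat \<Rightarrow> nat \<Rightarrow> bool" where
  "ancestor v w \<longleftrightarrow> (\<exists>d. v = drop_bit d w)"

lemma ancestor_drop_bit: "ancestor (drop_bit d w) w"
  unfolding ancestor_def by blast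

lemma ancestor_refl: "ancestor v v"
  using ancestor_drop_bit[of 0 v] by simp

lemma ancestor_half:
  assumes "ancestor v w"
  shows "ancestor (v div 2) w"
  using assms unfolding ancestor_def by (metis drop_bit_Suc drop_bit_half)

lemma proper_ancestorE:
  assumes "ancestor v w" "v \<noteq> w"
  obtains d where "v = drop_bit d w div 2"
proof -
  obtain e where depth: "v = drop_bit e w"
    using assms(1) by (auto simp: ancestor_def)
  with assms(2) obtain d where "e = Suc d"
    by (cases e) auto
  then show thesis
    using depth that by (simp add: drop_bit_Suc drop_bit_half)
qed

lemma proper_ancestor_le_half:
  assumes "ancestor v w" "v \<noteq> w"
  shows "v \<le> w div 2"
proof -
  obtain d where "v = drop_bit d w div 2"
    using assms by (rule proper_ancestorE)
  moreover have "drop_bit d w \<le> w"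
    by (simp add: drop_bit_eq_div)
  ultimately show ?thesis
    using div_le_mono by blast
qed

lemma ancestor_eq_on_level:
  assumes "ancestor v w" "b \<le> v" "w < 2 * b"
  shows "v = w"
  using proper_ancestor_le_half[OF assms(1)] assms(2,3) by linarith

lemma ancestors_comparable:
  assumes "ancestor u w" "ancestor v w"
  shows "ancestor u v \<or> ancestor v u"
proof -
  obtain d e where "u = drop_bit d w" "v = drop_bit e w"
    using assms by (auto simp: ancestor_def)
  then show ?thesis
    unfolding ancestor_def by (metis drop_bit_drop_bit le_add_diff_inverse2 nat_le_linear)
qed

lemma ancestor_unique_on_level:
  assumes "ancestor r v" "ancestor r' v" "r \<in> {b..<2 * b}" "r' \<in> {b..<2 * b}"
  shows "r = r'"
  using ancestors_comparable[OF assms(1,2)] ancestor_eq_on_level[of r r' b]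
    ancestor_eq_on_level[of r' r b] assms(3,4) by auto

lemma exists_ancestor_on_level:
  assumes "0 < b" "b \<le> v"
  shows "\<exists>r \<in> {b..<2 * b}. ancestor r v"
  using \<open>b \<le> v\<close>
proof (induction v rule: less_induct)
  case (less v)
  show ?case
  proof (cases "v < 2 * b")
    case True
    then show ?thesis
      using less.prems ancestor_refl[of v] by auto
  next
    case False
    then obtain r where "r \<in> {b..<2 * b}" "ancestor r (v div 2)"
      using less.IH[of "v div 2"] \<open>0 < b\<close> by force
    then show ?thesis
      unfolding ancestor_def by (metis drop_bit_Suc)
  qed
qed

section \<open>Heap forests joined to sinks\<close>

text \<open>
  Cutting the heap off below \<open>a\<close> leaves the \<open>a\<close> trees rooted at \<open>a, \<dots>, 2 * a - 1\<close>, whose leaves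
  are \<open>m, \<dots>, 2 * m - 1\<close>. The source is \<open>0\<close>.
\<close>

locale heap_forest =
  fixes a m N :: nat
  assumes a_pos: "1 \<le> a" and a_le_m: "a \<le> m" and m_le_N: "2 * m \<le> N"
begin

abbreviation roots :: "nat set" where "roots \<equiv> {a..<2 * a}"
abbreviation leaves :: "nat set" where "leaves \<equiv> {m..<2 * m}"
abbreviation sinks :: "nat set" where "sinks \<equiv> {2 * m..<N}"

definition heap_arcs :: "(nat \<times> nat) set" where
  "heap_arcs = {0} \<times> roots \<union> (\<lambda>w. (w div 2, w)) ` {2 * a..<2 * m} \<union> leaves \<times> sinks"

definition heap_graph :: "(nat, nat \<times> nat) pre_digraph" where
  "heap_graph = \<lparr> verts = insert 0 {a..<N}, arcs = heap_arcs, tail = fst, head = snd \<rparr>"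

definition branch_arcs :: "nat \<Rightarrow> (nat \<times> nat) set" where
  "branch_arcs j =
     (\<lambda>w. (w div 2, w)) ` {w \<in> {2 * a..<2 * m}. ancestor (w div 2) j \<and> \<not> ancestor w j}"

abbreviation pruned_graph :: "nat \<Rightarrow> (nat, nat \<times> nat) pre_digraph" where
  "pruned_graph j \<equiv> del_arcs heap_graph (branch_arcs j)"

lemma heap_graph_simps [simp]:
  "verts heap_graph = insert 0 {a..<N}"
  "arcs heap_graph = heap_arcs"
  "tail heap_graph = fst"
  "head heap_graph = snd"
  by (simp_all add: heap_graph_def)

sublocale digraph heap_graph
proof
  show "finite (arcs heap_graph)"
    by (simp add: heap_arcs_def)
qed (use a_pos a_le_m m_le_N in \<open>auto simp: heap_arcs_def arc_to_ends_def\<close>)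

sublocale pruned: fin_digraph "pruned_graph j" for j
  by (rule fin_digraph_del_arcs)

lemma card_verts_heap_graph: "card (verts heap_graph) = Suc (N - a)"
  using a_pos by simp

lemma branch_arcs_subset: "branch_arcs j \<subseteq> arcs heap_graph"
  by (auto simp: branch_arcs_def heap_arcs_def)

lemma branch_arcsE:
  assumes "e \<in> branch_arcs j" "j \<in> leaves"
  obtains w d where "e = (w div 2, w)" "w div 2 = drop_bit d j div 2"
    "\<not> ancestor w j" "a \<le> w div 2"
proof -
  obtain w where w: "e = (w div 2, w)" "w \<in> {2 * a..<2 * m}" "ancestor (w div 2) j" "\<not> ancestor w j"
    using assms(1) by (auto simp: branch_arcs_def)
  then have "w div 2 \<noteq> j" "a \<le> w div 2"
    using assms(2) by auto
  then show thesis
    using w that by (elim proper_ancestorE[of "w div 2" j]) auto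
qed

lemma inj_on_fst_branch_arcs:
  assumes leaf: "j \<in> leaves"
  shows "inj_on fst (branch_arcs j)"
proof (rule inj_onI)
  fix e e' assume "e \<in> branch_arcs j" "e' \<in> branch_arcs j" "fst e = fst e'"
  obtain w d where w: "e = (w div 2, w)" "w div 2 = drop_bit d j div 2" "\<not> ancestor w j"
    using \<open>e \<in> branch_arcs j\<close> leaf by (rule branch_arcsE)
  obtain w' where w': "e' = (w' div 2, w')" "\<not> ancestor w' j"
    using \<open>e' \<in> branch_arcs j\<close> leaf by (rule branch_arcsE)
  define p where "p = w div 2"
  have child_cases: "v = 2 * p \<or> v = 2 * p + 1" if "v div 2 = p" for v
    using that by linarith
  have "w \<noteq> drop_bit d j" "w' \<noteq> drop_bit d j"
    using w(3) w'(2) ancestor_drop_bit by auto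
  moreover have "w' div 2 = p" "drop_bit d j div 2 = p"
    using \<open>fst e = fst e'\<close> w(1,2) w'(1) by (simp_all add: p_def)
  ultimately have "w = w'"
    using child_cases[of w] child_cases[of w'] child_cases[of "drop_bit d j"] p_def by linarith
  with w(1) w'(1) show "e = e'" by simp
qed

lemma card_branch_arcs_le:
  assumes leaf: "j \<in> leaves" and "m \<le> 2 ^ k * a"
  shows "card (branch_arcs j) \<le> k"
proof -
  have "card (branch_arcs j) = card (fst ` branch_arcs j)"
    using inj_on_fst_branch_arcs[OF leaf] by (simp add: card_image)
  also have "\<dots> \<le> card ((\<lambda>d. drop_bit d j div 2) ` {..<k})"
  proof (intro card_mono subsetI)
    fix v assume "v \<in> fst ` branch_arcs j"
    then obtain e where "e \<in> branch_arcs j" "v = fst e"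
      by blast
    then obtain w d where w: "e = (w div 2, w)" "w div 2 = drop_bit d j div 2" "a \<le> w div 2"
      using leaf by (elim branch_arcsE)
    then have "2 ^ Suc d * a \<le> j"
      by (simp add: drop_bit_eq_div less_eq_div_iff_mult_less_eq ac_simps)
    also have "j < 2 ^ Suc k * a"
      using leaf \<open>m \<le> 2 ^ k * a\<close> by simp
    finally have "d < k"
      by simp
    then show "v \<in> (\<lambda>d. drop_bit d j div 2) ` {..<k}"
      using w(1,2) \<open>v = fst e\<close> by simp
  qed simp
  also have "\<dots> \<le> k"
    using card_image_le[of "{..<k}" "\<lambda>d. drop_bit d j div 2"] by simp
  finally show ?thesis .
qed

lemma exists_child_off_branch:
  assumes leaf: "j \<in> leaves" and "v < m"
  shows "\<exists>w. w div 2 = v \<and> (v, w) \<notin> branch_arcs j"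
proof (cases "ancestor v j")
  case True
  moreover have "v \<noteq> j"
    using assms by auto
  ultimately obtain d where "v = drop_bit d j div 2"
    by (rule proper_ancestorE)
  then show ?thesis
    using ancestor_drop_bit by (intro exI[of _ "drop_bit d j"]) (auto simp: branch_arcs_def)
next
  case False
  then show ?thesis
    by (intro exI[of _ "2 * v"]) (auto simp: branch_arcs_def)
qed

lemma pruned_awalk_to_sink:
  assumes leaf: "j \<in> leaves" and sink: "x \<in> sinks" and start: "v \<in> {a..<2 * m}"
  shows "\<exists>p. pruned.awalk j v p x \<and> (\<forall>e \<in> set p. ancestor v (fst e))"
  using start
proof (induction v rule: measure_induct_rule[of "\<lambda>v. 2 * m - v"])
  case (less v)
  show ?case
  proof (cases "m \<le> v")
    case True
    then have "(v, x) \<in> heap_arcs - branch_arcs j"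
      using less.prems sink by (auto simp: heap_arcs_def branch_arcs_def)
    then have "pruned.awalk j v [(v, x)] x"
      using sink a_le_m by (simp add: pruned.awalk_simps)
    then show ?thesis
      using ancestor_refl by (intro exI[of _ "[(v, x)]"]) simp
  next
    case False
    then obtain w where child: "w div 2 = v" "(v, w) \<notin> branch_arcs j"
      using exists_child_off_branch[OF leaf, of v] by auto
    have child_range: "w \<in> {2 * a..<2 * m}" "v < w"
      using child(1) less.prems False a_pos by auto
    then obtain p where walk: "pruned.awalk j w p x" "\<forall>e \<in> set p. ancestor w (fst e)"
      using less.IH[of w] less.prems by fastforce
    have "(v, w) \<in> heap_arcs"
      using child(1) child_range(1) by (auto simp: heap_arcs_def)
    then have "pruned.awalk j v ((v, w) # p) x"
      using walk(1) child(2) by (simp add: pruned.awalk_Cons_iff)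
    moreover have "\<forall>e \<in> set p. ancestor v (fst e)"
      using walk(2) child(1) ancestor_half by auto
    ultimately show ?thesis
      using ancestor_refl by (intro exI[of _ "(v, w) # p"]) auto
  qed
qed

lemma le_max_flow_pruned_graph:
  assumes leaf: "j \<in> leaves" and sink: "x \<in> sinks"
  shows "a \<le> max_flow 0 x (pruned_graph j)"
proof -
  have "\<exists>p. pruned.awalk j r p x \<and> (\<forall>e \<in> set p. ancestor r (fst e))" if "r \<in> roots" for r
    using pruned_awalk_to_sink[OF leaf sink] that a_le_m by auto
  then obtain p where walk: "\<And>r. r \<in> roots \<Longrightarrow> pruned.awalk j r (p r) x"
    and anc: "\<And>r e. r \<in> roots \<Longrightarrow> e \<in> set (p r) \<Longrightarrow> ancestor r (fst e)"
    by metis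
  have "disjoint_family_on (\<lambda>r. set ((0, r) # p r)) roots"
    unfolding disjoint_family_on_def
  proof (intro ballI impI)
    fix r r' assume roots: "r \<in> roots" "r' \<in> roots" "r \<noteq> r'"
    have "(0, s) \<notin> set (p r)" if "r \<in> roots" for r s
      using anc[OF that, of "(0, s)"] that a_pos by (auto simp: ancestor_def)
    moreover have "set (p r) \<inter> set (p r') = {}"
      using roots anc ancestor_unique_on_level[of r _ r' a] by blast
    ultimately show "set ((0, r) # p r) \<inter> set ((0, r') # p r') = {}"
      using roots by auto
  qed
  moreover have "pruned.awalk j 0 ((0, r) # p r) x" if "r \<in> roots" for r
  proof -
    have "(0, r) \<in> heap_arcs - branch_arcs j"
      using that a_pos by (auto simp: heap_arcs_def branch_arcs_def)
    then show ?thesis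
      using walk[OF that] by (simp add: pruned.awalk_Cons_iff)
  qed
  ultimately have "card roots \<le> max_flow 0 x (pruned_graph j)"
    using sink a_pos a_le_m by (intro pruned.card_le_max_flow) auto
  then show ?thesis by simp
qed

definition cut_side :: "nat \<Rightarrow> nat \<Rightarrow> nat set" where
  "cut_side j x = {0} \<union> {v. ancestor v j} \<union> sinks - {x}"

lemma leaf_arc_in_cut_arcs:
  assumes "j \<in> leaves" "x \<in> sinks"
  shows "(j, x) \<in> cut_arcs (pruned_graph j) (cut_side j x)"
  using assms ancestor_refl[of j]
  by (auto simp: cut_arcs_def cut_side_def heap_arcs_def branch_arcs_def)

lemma cut_arcs_pruned_graph_subset:
  assumes leaf: "j \<in> leaves" and sink: "x \<in> sinks" and root: "r \<in> roots" "ancestor r j"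
  shows "cut_arcs (pruned_graph j) (cut_side j x) \<subseteq> insert (j, x) ({0} \<times> (roots - {r}))"
proof
  fix e assume "e \<in> cut_arcs (pruned_graph j) (cut_side j x)"
  then obtain u w where arc: "e = (u, w)" "(u, w) \<in> heap_arcs" "(u, w) \<notin> branch_arcs j"
    and tail_side: "u \<in> cut_side j x" and head_side: "w \<notin> cut_side j x"
    by (cases e) (auto simp: cut_arcs_def)
  from arc(2) consider (root_arc) "u = 0" "w \<in> roots"
    | (tree_arc) "w \<in> {2 * a..<2 * m}" "u = w div 2"
    | (leaf_arc) "u \<in> leaves" "w \<in> sinks"
    unfolding heap_arcs_def by auto
  then show "e \<in> insert (j, x) ({0} \<times> (roots - {r}))"
  proof cases
    case root_arc
    moreover have "w \<noteq> r"
      using head_side root sink a_le_m by (auto simp: cut_side_def)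
    ultimately show ?thesis using arc(1) by simp
  next
    case tree_arc
    then have "ancestor u j"
      using tail_side a_pos by (auto simp: cut_side_def)
    then have "ancestor w j"
      using tree_arc arc(3) by (auto simp: branch_arcs_def)
    then show ?thesis
      using head_side tree_arc sink by (auto simp: cut_side_def)
  next
    case leaf_arc
    then have "ancestor u j"
      using tail_side a_pos a_le_m by (auto simp: cut_side_def)
    then have "u = j"
      using leaf_arc leaf by (intro ancestor_eq_on_level[of u j m]) auto
    moreover have "w = x"
      using head_side leaf_arc by (auto simp: cut_side_def)
    ultimately show ?thesis using arc(1) by simp
  qed
qed

lemma card_cut_arcs_pruned_graph_le:
  assumes leaf: "j \<in> leaves" and sink: "x \<in> sinks"
  shows "card (cut_arcs (pruned_graph j) (cut_side j x)) \<le> a"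
proof -
  obtain r where root: "r \<in> roots" "ancestor r j"
    using exists_ancestor_on_level[of a j] leaf a_pos a_le_m by auto
  have "card (cut_arcs (pruned_graph j) (cut_side j x))
      \<le> card (insert (j, x) ({0} \<times> (roots - {r})))"
    using cut_arcs_pruned_graph_subset[OF leaf sink root] by (intro card_mono) auto
  also have "\<dots> \<le> a"
    by (rule card_insert_le_m1) (use root(1) a_pos in \<open>auto simp: card_cartesian_product\<close>)
  finally show ?thesis .
qed

lemma card_arcs_ft_bfp_heap_graph:
  assumes "a \<le> l" "m \<le> 2 ^ k * a" and preserver: "ft_bfp l k heap_graph 0 H"
  shows "m * (N - 2 * m) \<le> card (arcs H)"
proof -
  have "(j, x) \<in> arcs H" if leaf: "j \<in> leaves" and sink: "x \<in> sinks" for j x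
  proof -
    have "cut_arcs (pruned_graph j) (cut_side j x) \<subseteq> arcs H"
    proof (rule tight_cut_arcs_subset_ft_bfp[OF preserver branch_arcs_subset card_branch_arcs_le])
      show "card (cut_arcs (pruned_graph j) (cut_side j x)) \<le> max_flow 0 x (pruned_graph j)"
        using card_cut_arcs_pruned_graph_le[OF leaf sink] le_max_flow_pruned_graph[OF leaf sink]
        by linarith
      show "card (cut_arcs (pruned_graph j) (cut_side j x)) \<le> l"
        using card_cut_arcs_pruned_graph_le[OF leaf sink] \<open>a \<le> l\<close> by linarith
    qed (use leaf sink assms(2) a_pos a_le_m in \<open>auto simp: cut_side_def\<close>)
    then show ?thesis
      using leaf_arc_in_cut_arcs[OF leaf sink] by blast
  qed
  then have "leaves \<times> sinks \<subseteq> arcs H"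
    by auto
  then have "card (leaves \<times> sinks) \<le> card (arcs H)"
    by (rule card_mono[OF finite_arcs_ft_bfp[OF preserver]])
  then show ?thesis by simp
qed

end

section \<open>The lower bound\<close>

lemma exists_heap_graph_dense_ft_bfps:
  assumes "1 \<le> l" "3 \<le> n"
  shows "\<exists>G :: (nat, nat \<times> nat) pre_digraph. digraph G \<and> card (verts G) = n \<and> 0 \<in> verts G \<and>
    (\<forall>H. ft_bfp l k G 0 H \<longrightarrow> min (2 ^ k * l * n) (n\<^sup>2) \<le> 25 * card (arcs H))"
proof -
  define q where "q = n div 3"
  define a where "a = min l q"
  define m where "m = min (2 ^ k * l) q"
  define N where "N = n + a - 1"
  have q: "1 \<le> q" "3 * q \<le> n" "n \<le> 5 * q"
    using \<open>3 \<le> n\<close> unfolding q_def by presburger+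
  have "l \<le> 2 ^ k * l" "q \<le> 2 ^ k * q"
    by simp_all
  then have params: "1 \<le> a" "a \<le> m" "m \<le> q" "m \<le> 2 ^ k * a"
    using \<open>1 \<le> l\<close> q(1) unfolding a_def m_def nat_mult_min_right by linarith+
  interpret heap_forest a m N
    by unfold_locales (use params q in \<open>auto simp: N_def\<close>)
  have "min (2 ^ k * l * n) (n\<^sup>2) \<le> 25 * card (arcs H)" if "ft_bfp l k heap_graph 0 H" for H
  proof -
    have "2 ^ k * l * n \<le> 2 ^ k * l * (25 * q)"
      using q(3) by simp
    moreover have "n\<^sup>2 \<le> (5 * q)\<^sup>2"
      using q(3) by (rule power_mono) simp
    ultimately have "min (2 ^ k * l * n) (n\<^sup>2) \<le> min (2 ^ k * l * (25 * q)) ((5 * q)\<^sup>2)"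
      by (rule min.mono)
    also have "\<dots> = 25 * (m * q)"
      by (simp add: m_def power2_eq_square nat_mult_min_left nat_mult_min_right)
    also have "\<dots> \<le> 25 * (m * (N - 2 * m))"
      using params q by (simp add: N_def)
    also have "\<dots> \<le> 25 * card (arcs H)"
      using card_arcs_ft_bfp_heap_graph[OF _ _ that] params by (simp add: a_def)
    finally show ?thesis .
  qed
  moreover have "card (verts heap_graph) = n"
    using card_verts_heap_graph params q by (simp add: N_def)
  ultimately show ?thesis
    using digraph_axioms by (intro exI[of _ heap_graph]) simp
qed

lemma exists_digraph_dense_ft_bfps:
  assumes "1 \<le> l" "1 \<le> n"
  shows "\<exists>G :: (nat, nat \<times> nat) pre_digraph. digraph G \<and> card (verts G) = n \<and> 0 \<in> verts G \<and>
    (2 \<le> n \<longrightarrow> (\<forall>H. ft_bfp l k G 0 H \<longrightarrow> min (2 ^ k * l * n) (n\<^sup>2) \<le> 25 * card (arcs H)))"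
proof (cases "3 \<le> n")
  case True
  then show ?thesis
    using exists_heap_graph_dense_ft_bfps[OF assms(1)] by blast
next
  case False
  have "min (2 ^ k * l * n) (n\<^sup>2) \<le> 25 * card (arcs H)"
    if "2 \<le> n" "ft_bfp l k (star_graph n) 0 H" for H
  proof -
    have "n = 2" "1 \<le> card (arcs H)"
      using False that card_arcs_ft_bfp_star_graph[OF assms(1) that(2)] by auto
    then show ?thesis by simp
  qed
  then show ?thesis
    using digraph_star_graph[of n] assms(2)
    by (intro exI[of _ "star_graph n"]) simp
qed

theorem theorem2:
  shows "\<exists>c::real. c > 0 \<and>
    (\<forall>(l::nat) (k::nat) (n::nat). l \<ge> 1 \<and> k \<ge> 1 \<and> n \<ge> 1 \<longrightarrow>
      (\<exists>(G :: (nat, nat \<times> nat) pre_digraph) (s::nat).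
         digraph G \<and> card (verts G) = n \<and> s \<in> verts G \<and>
         (n \<ge> 2 \<longrightarrow>
           (\<forall>H. ft_bfp l k G s H \<longrightarrow>
              real (card (arcs H)) \<ge> c * min (2 ^ k * real l * real n) ((real n)\<^sup>2)))))"
proof (intro exI[of _ "1/25 :: real"] conjI allI impI)
  fix l k n :: nat
  assume "l \<ge> 1 \<and> k \<ge> 1 \<and> n \<ge> 1"
  then have "1 \<le> l" "1 \<le> n" by auto
  obtain G :: "(nat, nat \<times> nat) pre_digraph"
    where G: "digraph G" "card (verts G) = n" "0 \<in> verts G"
      and bound: "\<And>H. n \<ge> 2 \<Longrightarrow> ft_bfp l k G 0 H \<Longrightarrow>
        min (2 ^ k * l * n) (n\<^sup>2) \<le> 25 * card (arcs H)"
    using exists_digraph_dense_ft_bfps[OF \<open>1 \<le> l\<close> \<open>1 \<le> n\<close>, of k] by blast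
  have "1/25 * min (2 ^ k * real l * real n) ((real n)\<^sup>2) \<le> real (card (arcs H))"
    if "n \<ge> 2" "ft_bfp l k G 0 H" for H
  proof -
    have "real (min (2 ^ k * l * n) (n\<^sup>2)) \<le> real (25 * card (arcs H))"
      using bound[OF that] by (rule of_nat_mono)
    then show ?thesis by (simp add: of_nat_min)
  qed
  with G show "\<exists>(G :: (nat, nat \<times> nat) pre_digraph) (s::nat).
         digraph G \<and> card (verts G) = n \<and> s \<in> verts G \<and>
         (n \<ge> 2 \<longrightarrow>
           (\<forall>H. ft_bfp l k G s H \<longrightarrow>
              real (card (arcs H)) \<ge> 1/25 * min (2 ^ k * real l * real n) ((real n)\<^sup>2)))"
    by blast
qed simp

end
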